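(* Let $\{a_n\}_{n\ge0}$ be a sequence of nonzero real numbers and set $u_n=\dfrac{a_{n-1}a_{n+1}}{a_n^2}$ for $n\ge1$. Suppose there exist an integer $N_1$ and real sequences $\{f_n\}$ (upper bound) and $\{g_n\}$ (lower bound) such that $0<g_n<u_n<f_n$ for all $n\ge N_1$, and an integer $N_2$ such that \[ g_{n-1}\,g_n^2\,g_{n+1}-4f_n+3>0 \quad\text{for all } n\ge N_2 . \] Let $N=\max\{N_1,N_2\}$. Then $\{a_n\}_{n\ge N}$ satisfies the Laguerre inequality of order two, i.e. $a_na_{n+4}-4a_{n+1}a_{n+3}+3a_{n+2}^2\ge0$ for all $n\ge N$.
   Context: A sequence $\{a_n\}$ satisfies the Laguerre inequality of order $m$ at $n$ if $L_m(a_n):=\frac12\sum_{k=0}^{2m}(-1)^{k+m}\binom{2m}{k}a_{n+k}a_{2m-k+n}\ge0$; for $m=2$ this equals $a_na_{n+4}-4a_{n+1}a_{n+3}+3a_{n+2}^2$. *)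

theory Defs
  imports Complex_Main
begin

definition laguerre_L :: "nat \<Rightarrow> (nat \<Rightarrow> real) \<Rightarrow> nat \<Rightarrow> real" where
  "laguerre_L m a n =
     1 / 2 * (\<Sum>k = 0..2 * m. (- 1) ^ (k + m) * real ((2 * m) choose k) * a (n + k) * a (2 * m - k + n))"

definition satisfies_laguerre :: "nat \<Rightarrow> (nat \<Rightarrow> real) \<Rightarrow> nat \<Rightarrow> bool" where
  "satisfies_laguerre m a n \<longleftrightarrow> laguerre_L m a n \<ge> 0"

lemma laguerre_L_2:
  "laguerre_L 2 a n = a n * a (n + 4) - 4 * a (n + 1) * a (n + 3) + 3 * (a (n + 2))\<^sup>2"
proof -
  have c: "(4::nat) choose 2 = 6" "(4::nat) choose 3 = 4"
    by (simp_all add: binomial_fact' fact_numeral numeral_eq_Suc)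
  have s: "{0..4::nat} = {0, 1, 2, 3, 4}"
    by auto
  show ?thesis
    by (simp add: laguerre_L_def s c power2_eq_square algebra_simps)
qed

end

theory Submission
  imports Defs
begin

text \<open>
  Dividing the second-order Laguerre expression at \<open>n\<close> by the square of \<open>a (n + 2)\<close> gives
  \<open>u (n + 1) * (u (n + 2))\<^sup>2 * u (n + 3) - 4 * u (n + 2) + 3\<close>; bounding the product from below by \<open>g\<close>
  and the linear term from above by \<open>f\<close> reduces its positivity to the hypothesis at index \<open>n + 2\<close>.
\<close>

theorem theorem5p1:
  fixes a u f g :: "nat \<Rightarrow> real" and N1 N2 N :: int
  assumes a_nonzero: "\<And>n. a n \<noteq> 0"
    and u: "\<And>n. n \<ge> 1 \<Longrightarrow> u n = a (n - 1) * a (n + 1) / (a n)\<^sup>2"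
    and bounds: "\<And>n. n \<ge> 1 \<Longrightarrow> int n \<ge> N1 \<Longrightarrow> 0 < g n \<and> g n < u n \<and> u n < f n"
    and cond: "\<And>n. n \<ge> 1 \<Longrightarrow> int n \<ge> N2 \<Longrightarrow> g (n - 1) * (g n)\<^sup>2 * g (n + 1) - 4 * f n + 3 > 0"
    and N: "N = max N1 N2"
  shows "\<forall>n. int n \<ge> N \<longrightarrow>
           satisfies_laguerre 2 a n \<and>
           a n * a (n + 4) - 4 * a (n + 1) * a (n + 3) + 3 * (a (n + 2))\<^sup>2 \<ge> 0"
proof (intro allI impI)
  fix n :: nat
  assume "int n \<ge> N"
  then have n: "int n \<ge> N1" "int n \<ge> N2"
    using N by auto
  have u1: "u (n + 1) = a n * a (n + 2) / (a (n + 1))\<^sup>2"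
    using u[of "n + 1"] by simp
  have u2: "u (n + 2) = a (n + 1) * a (n + 3) / (a (n + 2))\<^sup>2"
    using u[of "n + 2"] by (simp add: eval_nat_numeral)
  have u3: "u (n + 3) = a (n + 2) * a (n + 4) / (a (n + 3))\<^sup>2"
    using u[of "n + 3"] by (simp add: eval_nat_numeral)
  have b1: "0 < g (n + 1)" "g (n + 1) < u (n + 1)"
    and b2: "0 < g (n + 2)" "g (n + 2) < u (n + 2)" "u (n + 2) < f (n + 2)"
    and b3: "0 < g (n + 3)" "g (n + 3) < u (n + 3)"
    using bounds[of "n + 1"] bounds[of "n + 2"] bounds[of "n + 3"] n by auto
  \<comment> \<open>Positivity of \<open>g\<close> makes every factor on both sides nonnegative, so
    the factorwise bounds multiply.\<close>
  have "g (n + 1) * (g (n + 2))\<^sup>2 * g (n + 3) \<le> u (n + 1) * (u (n + 2))\<^sup>2 * u (n + 3)"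
    using b1 b2 b3 by (intro mult_mono power_mono) auto
  moreover have "g (n + 1) * (g (n + 2))\<^sup>2 * g (n + 3) - 4 * f (n + 2) + 3 > 0"
    using cond[of "n + 2"] n by (simp add: eval_nat_numeral)
  ultimately have pos: "u (n + 1) * (u (n + 2))\<^sup>2 * u (n + 3) - 4 * u (n + 2) + 3 \<ge> 0"
    using b2 by linarith
  \<comment> \<open>The numerator of \<open>(u (n + 2))\<^sup>2\<close> cancels the denominators of
    \<open>u (n + 1)\<close> and \<open>u (n + 3)\<close>, so the product of ratios collapses to
    \<open>a n * a (n + 4) / (a (n + 2))\<^sup>2\<close>.\<close>
  have "a n * a (n + 4) - 4 * a (n + 1) * a (n + 3) + 3 * (a (n + 2))\<^sup>2
      = (a (n + 2))\<^sup>2 * (u (n + 1) * (u (n + 2))\<^sup>2 * u (n + 3) - 4 * u (n + 2) + 3)"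
    unfolding u1 u2 u3
    using a_nonzero[of "n + 1"] a_nonzero[of "n + 2"] a_nonzero[of "n + 3"]
    by (simp add: field_simps power2_eq_square)
  then have "a n * a (n + 4) - 4 * a (n + 1) * a (n + 3) + 3 * (a (n + 2))\<^sup>2 \<ge> 0"
    using pos by simp
  then show "satisfies_laguerre 2 a n \<and>
      a n * a (n + 4) - 4 * a (n + 1) * a (n + 3) + 3 * (a (n + 2))\<^sup>2 \<ge> 0"
    by (simp add: satisfies_laguerre_def laguerre_L_2)
qed

end
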